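(* Let $S=\{(\mathbf{x}^i,y^i)\}_{i=1}^n$ be i.i.d. from an (arbitrary, unknown) distribution $\mathbb{P}_{\mathbf{x},y}$ on $\mathcal{X}\times\mathcal{Y}$, and let $(\tilde{\mathbf{x}}^j,\tilde y^j)$, $j=1,\dots,m$, be i.i.d. from $\mathbb{P}_{\mathbf{x},y}$ and independent of $S$. Let $\mathcal{I}$ be a class of set functions $I:\mathcal{X}\to\mathfrak{M}_{\mathbb{R}}$, and let $I^{\mathrm{Alg}}\in\mathcal{I}$ be the set function that a learning procedure outputs from $S$ (for instance, a minimizer over $I\in\mathcal{I}$ of $\frac1n\sum_{i=1}^n\mathbf{1}[y^i\notin I(\mathbf{x}^i)]$). Define the uncertainty set $$\mathcal{U}=\prod_{j=1}^m I^{\mathrm{Alg}}(\tilde{\mathbf{x}}^j)\subseteq\mathbb{R}^m,$$ and let $\pi^*$ be an optimal solution of the robust problem $$\min_{\pi\in\Pi}\max_{\mathbf{u}\in\mathcal{U}} f(\pi,\mathbf{u})\quad\text{s.t.}\quad F(\pi,\mathbf{u})\in\mathcal{K}\ \text{ for all }\mathbf{u}\in\mathcal{U}.$$ Then for every $\delta\in(0,1)$, with probability at least $1-\delta$ over the training sample $S$, $$\mathbb{P}_{\{\tilde{\mathbf{x}}^j,\tilde y^j\}_{j=1}^m}\Big(F(\pi^*,[\tilde y^1\cdots\tilde y^m]^T)\in\mathcal{K}\Big)\ \ge\ \left(\left[1-\frac1n\sum_{i=1}^n\mathbf{1}[y^i\notin I^{\mathrm{Alg}}(\mathbf{x}^i)]-2\mathcal{R}(l\circ\mathcal{I})-\sqrt{\frac{\log\frac1\delta}{2n}}\right]_+\right)^m,$$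 where $[\cdot]_+=\max(0,\cdot)$, $l(I(\mathbf{x}),y)=\mathbf{1}[y\notin I(\mathbf{x})]$, and $\mathcal{R}(l\circ\mathcal{I})$ is the Rademacher average of $l\circ\mathcal{I}=\{(\mathbf{x},y)\mapsto l(I(\mathbf{x}),y): I\in\mathcal{I}\}$.
   Context: $\mathcal{X}\subseteq\mathbb{R}^d$ is the feature space, $\mathcal{Y}\subseteq\mathbb{R}$ the label space, and $\mathfrak{M}_{\mathbb{R}}$ is the collection of measurable subsets of $\mathbb{R}$. $\mathbf{1}[\cdot]$ is the indicator function. Decision problem: $\Pi\subseteq\mathbb{R}^{d_1}$ is the set of decisions, $f:\Pi\times\mathbb{R}^m\to\mathbb{R}$ the objective, $F:\Pi\times\mathbb{R}^m\to\mathbb{R}^{d_2}$ the constraint function, and $\mathcal{K}\subseteq\mathbb{R}^{d_2}$ a convex cone. The solution $\pi^*$ (assumed to exist) depends on $S$ and on $\tilde{\mathbf{x}}^1,\dots,\tilde{\mathbf{x}}^m$ through $\mathcal{U}$. Rademacher average: for a class $\mathcal{F}$ of real-valued functions and a sample $S'=\{z^i\}_{i=1}^n$, the empirical Rademacher average is $\mathcal{R}_{S'}(\mathcal{F})=\mathbb{E}_{\sigma^1,\dots,\sigma^n}\big[\frac1n\sup_{g\in\mathcal{F}}\big|\sum_{i=1}^n\sigma^i g(z^i)\big|\big]$, where the $\sigma^i$ are independent and equal to $\pm1$ with probability $1/2$ each. The Rademacher average is $\mathcal{R}(\mathcal{F})=\mathbb{E}[\mathcal{R}_{S'}(\mathcal{F})]$,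 the expectation being over the i.i.d. sample; here $z^i=(\mathbf{x}^i,y^i)$. Convention: all sets, functions, suprema and data-dependent selections are taken to be measurable as needed for the probabilities and expectations to make sense. *)

theory Defs
  imports "HOL-Probability.Probability"
begin

abbreviation iid :: "'i set \<Rightarrow> 'z measure \<Rightarrow> ('i \<Rightarrow> 'z) measure" where
  "iid J P \<equiv> PiM J (\<lambda>_. P)"

(* Outside {..<n} the sign vectors take the dummy value 0, which is never used. *)
definition rademacher_signs :: "nat \<Rightarrow> (nat \<Rightarrow> real) pmf" where
  "rademacher_signs n = Pi_pmf {..<n} 0 (\<lambda>_. pmf_of_set {-1, 1})"

(* Real-valued SUP is the actual supremum only for a nonempty class that is bounded on the
   sample; the loss classes below take values in {0,1}. *)
definition emp_rademacher :: "nat \<Rightarrow> ('z \<Rightarrow> real) set \<Rightarrow> (nat \<Rightarrow> 'z) \<Rightarrow> real" where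
  "emp_rademacher n G z =
     measure_pmf.expectation (rademacher_signs n)
       (\<lambda>\<sigma>. 1 / real n * (SUP g\<in>G. \<bar>\<Sum>i<n. \<sigma> i * g (z i)\<bar>))"

definition rademacher :: "'z measure \<Rightarrow> nat \<Rightarrow> ('z \<Rightarrow> real) set \<Rightarrow> real" where
  "rademacher P n G = (\<integral>z. emp_rademacher n G z \<partial>iid {..<n} P)"

definition miscoverage :: "('x \<Rightarrow> real set) \<Rightarrow> 'x \<times> real \<Rightarrow> real" where
  "miscoverage I = (\<lambda>(x, y). of_bool (y \<notin> I x))"

definition emp_miscoverage ::
    "nat \<Rightarrow> ('x \<Rightarrow> real set) \<Rightarrow> (nat \<Rightarrow> 'x \<times> real) \<Rightarrow> real" where
  "emp_miscoverage n I S = 1 / real n * (\<Sum>i<n. miscoverage I (S i))"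

definition uncertainty_set ::
    "('x \<Rightarrow> real set) \<Rightarrow> ('m \<Rightarrow> 'x) \<Rightarrow> (real ^ 'm) set" where
  "uncertainty_set I x = {u. \<forall>j. u $ j \<in> I (x j)}"

(* The inner maximum is read as a supremum in the extended reals, so it need neither be
   attained nor be finite; it is - \<infinity> for an empty uncertainty set. *)
definition robust_optimal ::
    "'p set \<Rightarrow> ('p \<Rightarrow> 'u \<Rightarrow> real) \<Rightarrow> ('p \<Rightarrow> 'u \<Rightarrow> 'c) \<Rightarrow> 'c set \<Rightarrow> 'u set \<Rightarrow> 'p \<Rightarrow> bool" where
  "robust_optimal D f F K U =
     is_arg_min (\<lambda>\<pi>. SUP u\<in>U. ereal (f \<pi> u)) (\<lambda>\<pi>. \<pi> \<in> D \<and> (\<forall>u\<in>U. F \<pi> u \<in> K))"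

end

theory Submission
  imports Defs
begin

text \<open>
  If every test label \<open>y\<^sub>j\<close> lies in the set predicted at \<open>x\<^sub>j\<close>, then the vector of labels belongs to the
  uncertainty set, and a robust solution, being feasible for the whole uncertainty set, satisfies the
  constraint at that vector. For a fixed training sample the test points are independent, so this
  event has probability \<open>(1 - p)\<^sup>m\<close>, where \<open>p\<close> is the miscoverage probability of the learned set function
  and \<open>m\<close> the number of test points (\<open>prob_joint_coverage\<close>). It remains to bound \<open>p\<close> by the empirical
  miscoverage. Since the set function depends on the sample, this needs a bound that is uniform over
  the class of losses (\<open>uniform_deviation\<close>).

  The classical argument applies McDiarmid's bounded difference inequality to the largest deviation
  \<open>\<Phi> S\<close> of true means from empirical means and bounds the expectation of \<open>\<Phi>\<close> by symmetrization with a ghost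
  sample. However, \<open>\<Phi>\<close> is a supremum over a possibly uncountable class and need not be measurable, and
  neither need the supremum over pairs of samples that occurs in the symmetrization. Both arguments are
  therefore carried out with a measurable majorant of \<open>\<Phi>\<close>. For each sign vector \<open>\<sigma>\<close>, swapping the samples
  \<open>S\<close> and \<open>T\<close> where \<open>\<sigma> i = -1\<close> turns a difference of sample sums into a difference of two \<open>\<sigma>\<close>-signed sums, each
  of which is bounded by the supremum in the Rademacher average of a swapped sample. Averaging over \<open>\<sigma>\<close>
  and integrating over \<open>T\<close> gives \<open>deviation_majorant\<close>. It dominates \<open>\<Phi>\<close> (\<open>deviation_le_majorant\<close>). Its
  mean is exactly twice the Rademacher average, because swapping preserves the law of two independent
  samples (\<open>integral_deviation_majorant\<close>). A change of one point of \<open>S\<close> affects only one of the two swapped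
  samples, so its differences are bounded by \<open>1 / n\<close> (\<open>bounded_differences_deviation_majorant\<close>), and
  \<open>McDiarmid\<close> yields the term with \<open>\<delta>\<close> with the classical constant.
\<close>

section \<open>McDiarmid's bounded difference inequality\<close>

text \<open>
  Bounding the oscillation by \<open>c\<close> confines \<open>f\<close> to an interval of length \<open>c\<close> whose position is unknown.
  This is the form in which Hoeffding's lemma is applied to the sections of a function with bounded
  differences: all sections oscillate by at most \<open>c\<close>, but each around its own level.
\<close>
lemma (in prob_space) Hoeffding_mgf_oscillation:
  fixes f :: "'a \<Rightarrow> real"
  assumes [measurable]: "f \<in> borel_measurable M" and l: "l > 0"
    and osc: "\<And>x y. x \<in> space M \<Longrightarrow> y \<in> space M \<Longrightarrow> f y - f x \<le> c"
  shows "expectation (\<lambda>x. exp (l * f x)) \<le> exp (l * expectation f + l\<^sup>2 * c\<^sup>2 / 8)"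
proof -
  define a where "a = Inf (f ` space M)"
  obtain x0 where x0: "x0 \<in> space M" using not_empty by auto
  have bdd: "bdd_below (f ` space M)"
    using osc[OF _ x0] by (intro bdd_belowI2[of _ "f x0 - c"]) (simp add: algebra_simps)
  have range: "f x \<in> {a..a + c}" if "x \<in> space M" for x
  proof -
    have "f x - c \<le> a"
      unfolding a_def using osc[OF _ that] not_empty by (intro cINF_greatest) (auto simp: algebra_simps)
    moreover have "a \<le> f x"
      unfolding a_def by (intro cINF_lower bdd that)
    ultimately show ?thesis by auto
  qed
  interpret I: interval_bounded_random_variable M f a "a + c"
  proof unfold_locales
    show "AE x in M. f x \<in> {a..a + c}" by (rule AE_I2) (rule range)
  qed simp
  let ?\<mu> = "expectation f"
  have int: "integrable M (\<lambda>x. exp (l * f x))"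
  proof (intro integrable_const_bound[of _ "exp (l * (a + c))"] AE_I2)
    show "norm (exp (l * f x)) \<le> exp (l * (a + c))" if "x \<in> space M" for x
      using range[OF that] l by (simp add: mult_left_mono)
  qed simp
  have "ennreal (expectation (\<lambda>x. exp (l * (f x - ?\<mu>)))) = nn_integral M (\<lambda>x. exp (l * (f x - ?\<mu>)))"
    using integrable_mult_left[OF int, of "exp (- l * ?\<mu>)"]
    by (intro nn_integral_eq_integral[symmetric]) (auto simp: algebra_simps mult_exp_exp)
  also have "\<dots> \<le> ennreal (exp (l\<^sup>2 * (a + c - ?\<mu> - (a - ?\<mu>))\<^sup>2 / 8))"
    using I.Hoeffdings_lemma_nn_integral[OF l] by simp
  finally have "expectation (\<lambda>x. exp (l * (f x - ?\<mu>))) \<le> exp (l\<^sup>2 * c\<^sup>2 / 8)"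
    by (simp add: ennreal_le_iff)
  moreover have "expectation (\<lambda>x. exp (l * f x)) = exp (l * ?\<mu>) * expectation (\<lambda>x. exp (l * (f x - ?\<mu>)))"
    unfolding integral_mult_right_zero[symmetric] mult_exp_exp by (simp add: algebra_simps)
  ultimately show ?thesis by (simp add: exp_add)
qed

definition bounded_differences ::
    "'i set \<Rightarrow> ('i \<Rightarrow> 'a measure) \<Rightarrow> ('i \<Rightarrow> real) \<Rightarrow> (('i \<Rightarrow> 'a) \<Rightarrow> real) \<Rightarrow> bool" where
  "bounded_differences J M c V \<longleftrightarrow>
     (\<forall>x\<in>space (PiM J M). \<forall>i\<in>J. \<forall>y\<in>space (M i). \<bar>V (x(i := y)) - V x\<bar> \<le> c i)"

lemma bounded_differencesD:
  "bounded_differences J M c V \<Longrightarrow> x \<in> space (PiM J M) \<Longrightarrow> i \<in> J \<Longrightarrow> y \<in> space (M i) \<Longrightarrow>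
    \<bar>V (x(i := y)) - V x\<bar> \<le> c i"
  by (auto simp: bounded_differences_def)

text \<open>
  Changing \<open>x\<close> into \<open>z\<close> one coordinate at a time costs at most \<open>c i\<close> for coordinate \<open>i\<close>. Hence a function
  with bounded differences is bounded, which settles all integrability questions below.
\<close>
lemma bounded_differences_total:
  assumes "finite J" "bounded_differences J M c V"
    and x: "x \<in> space (PiM J M)" and z: "z \<in> space (PiM J M)"
  shows "\<bar>V z - V x\<bar> \<le> (\<Sum>i\<in>J. c i)"
proof -
  have "\<bar>V (override_on x z A) - V x\<bar> \<le> (\<Sum>i\<in>A. c i)" if "finite A" "A \<subseteq> J" for A
    using that
  proof (induction A)
    case (insert i A)
    have "override_on x z A \<in> space (PiM J M)"
      using x z by (auto simp: space_PiM override_on_def PiE_iff extensional_def)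
    moreover have "z i \<in> space (M i)"
      using z insert.prems by (auto simp: space_PiM)
    ultimately have "\<bar>V ((override_on x z A)(i := z i)) - V (override_on x z A)\<bar> \<le> c i"
      using bounded_differencesD[OF assms(2)] insert.prems by auto
    then show ?case using insert unfolding override_on_insert by (simp del: fun_upd_apply)
  qed simp
  from this[OF assms(1) order.refl] have "\<bar>V (override_on x z J) - V x\<bar> \<le> (\<Sum>i\<in>J. c i)" .
  moreover have "override_on x z J = z"
    using x z by (auto simp: override_on_def space_PiM PiE_iff extensional_def)
  ultimately show ?thesis by simp
qed

context product_prob_space
begin

lemma integrable_bounded_differences:
  assumes "finite J" "V \<in> borel_measurable (PiM J M)" "bounded_differences J M c V"
  shows "integrable (PiM J M) V"
proof -
  interpret J: prob_space "PiM J M" by (intro prob_space_PiM prob_space)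
  obtain x where x: "x \<in> space (PiM J M)" using J.not_empty by blast
  have "\<bar>V z\<bar> \<le> (\<Sum>i\<in>J. c i) + \<bar>V x\<bar>" if "z \<in> space (PiM J M)" for z
    using bounded_differences_total[OF assms(1,3) x that] by linarith
  then show ?thesis
    by (intro J.integrable_const_bound[of _ "(\<Sum>i\<in>J. c i) + \<bar>V x\<bar>"] AE_I2) (use assms in auto)
qed

lemma integrable_exp_bounded_differences:
  assumes "finite J" and [measurable]: "V \<in> borel_measurable (PiM J M)"
    and bd: "bounded_differences J M c V" and "l > 0"
  shows "integrable (PiM J M) (\<lambda>x. exp (l * V x))"
proof -
  interpret J: prob_space "PiM J M" by (intro prob_space_PiM prob_space)
  obtain x where x: "x \<in> space (PiM J M)" using J.not_empty by blast
  have "V z \<le> V x + (\<Sum>i\<in>J. c i)" if "z \<in> space (PiM J M)" for z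
    using bounded_differences_total[OF assms(1) bd x that] by linarith
  then show ?thesis using \<open>l > 0\<close>
    by (intro J.integrable_const_bound[of _ "exp (l * (V x + (\<Sum>i\<in>J. c i)))"] AE_I2) auto
qed

text \<open>
  The moment generating function tensorizes. To add a coordinate \<open>i\<close>, integrate it out first: for every
  value of the other coordinates, Hoeffding's lemma replaces \<open>exp (l * V)\<close> by \<open>exp (l * V')\<close> at the price of
  a factor \<open>exp (l\<^sup>2 * (c i)\<^sup>2 / 8)\<close>, where \<open>V'\<close> is the average of \<open>V\<close> over coordinate \<open>i\<close>. Averaging preserves
  the mean and the bounded differences in the remaining coordinates, so the induction hypothesis
  applies to \<open>V'\<close>. This takes the place of the usual martingale of conditional expectations.
\<close>
lemma mgf_bounded_differences:
  assumes "finite J" "V \<in> borel_measurable (PiM J M)" "bounded_differences J M c V" and l: "l > 0"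
  shows "(\<integral>x. exp (l * V x) \<partial>PiM J M) \<le> exp (l * (\<integral>x. V x \<partial>PiM J M) + l\<^sup>2 * (\<Sum>i\<in>J. (c i)\<^sup>2) / 8)"
  using assms(1-3)
proof (induction J arbitrary: V)
  case empty
  then show ?case
    by (simp add: PiM_empty lebesgue_integral_count_space_finite)
next
  case (insert i J)
  note [measurable] = \<open>V \<in> borel_measurable (PiM (insert i J) M)\<close>
  note bd = \<open>bounded_differences (insert i J) M c V\<close>
  let ?V' = "\<lambda>x. \<integral>y. V (x(i := y)) \<partial>M i"
  have upd: "x(i := y) \<in> space (PiM (insert i J) M)"
    if "x \<in> space (PiM J M)" "y \<in> space (M i)" for x y
    using that by (auto simp: space_PiM PiE_iff extensional_def)
  have osc: "V (x(i := z)) - V (x(i := y)) \<le> c i"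
    if "x \<in> space (PiM J M)" "y \<in> space (M i)" "z \<in> space (M i)" for x y z
    using bounded_differencesD[OF bd upd[OF that(1,2)] insertI1 that(3)] by simp
  have V_section [measurable]: "(\<lambda>y. V (x(i := y))) \<in> borel_measurable (M i)"
    if [simp]: "x \<in> space (PiM J M)" for x
    by measurable
  have int_section: "integrable (M i) (\<lambda>y. V (x(i := y)))" if x: "x \<in> space (PiM J M)" for x
  proof -
    obtain y where y: "y \<in> space (M i)" using M.not_empty by auto
    have "\<bar>V (x(i := z))\<bar> \<le> c i + \<bar>V (x(i := y))\<bar>" if "z \<in> space (M i)" for z
      using osc[OF x y that] osc[OF x that y] by linarith
    then show ?thesis using V_section[OF x]
      by (intro M.integrable_const_bound[of _ "c i + \<bar>V (x(i := y))\<bar>"] AE_I2) auto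
  qed
  have meas': "?V' \<in> borel_measurable (PiM J M)" by measurable
  have bd': "bounded_differences J M c ?V'"
    unfolding bounded_differences_def
  proof safe
    fix x j z assume x: "x \<in> space (PiM J M)" and j: "j \<in> J" and z: "z \<in> space (M j)"
    have xz: "x(j := z) \<in> space (PiM J M)"
      using x j z by (auto simp: space_PiM PiE_iff extensional_def)
    have diff: "\<bar>V (x(j := z, i := y)) - V (x(i := y))\<bar> \<le> c j" if y: "y \<in> space (M i)" for y
      using bounded_differencesD[OF bd upd[OF x y], of j z] j z insert.hyps
      by (metis fun_upd_twist insertI2)
    note int = int_section[OF x] int_section[OF xz]
    have "?V' (x(j := z)) - ?V' x = (\<integral>y. V (x(j := z, i := y)) - V (x(i := y)) \<partial>M i)"
      using int by simp
    also have "\<bar>\<dots>\<bar> \<le> (\<integral>y. \<bar>V (x(j := z, i := y)) - V (x(i := y))\<bar> \<partial>M i)"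
      by (rule integral_abs_bound)
    also have "\<dots> \<le> (\<integral>y. c j \<partial>M i)"
      using int diff by (intro integral_mono) auto
    finally show "\<bar>?V' (x(j := z)) - ?V' x\<bar> \<le> c j"
      by (simp add: M.prob_space)
  qed
  have fin: "finite (insert i J)" using insert.hyps by simp
  let ?e = "exp (l\<^sup>2 * (c i)\<^sup>2 / 8)"
  have "(\<integral>x. exp (l * V x) \<partial>PiM (insert i J) M) = (\<integral>x. (\<integral>y. exp (l * V (x(i := y))) \<partial>M i) \<partial>PiM J M)"
    by (intro product_integral_insert insert.hyps integrable_exp_bounded_differences[OF fin _ bd l]) simp
  also have "\<dots> \<le> (\<integral>x. exp (l * ?V' x) * ?e \<partial>PiM J M)"
  proof (rule integral_mono')
    show "integrable (PiM J M) (\<lambda>x. exp (l * ?V' x) * ?e)"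
      by (intro integrable_mult_left integrable_exp_bounded_differences[OF insert.hyps(1) meas' bd' l])
    fix x assume x: "x \<in> space (PiM J M)"
    show "(\<integral>y. exp (l * V (x(i := y))) \<partial>M i) \<le> exp (l * ?V' x) * ?e"
      using M.Hoeffding_mgf_oscillation[OF V_section[OF x] l, of "c i"] osc[OF x]
      by (simp add: exp_add)
  qed simp
  also have "\<dots> = (\<integral>x. exp (l * ?V' x) \<partial>PiM J M) * ?e" by simp
  also have "\<dots> \<le> exp (l * (\<integral>x. ?V' x \<partial>PiM J M) + l\<^sup>2 * (\<Sum>i\<in>J. (c i)\<^sup>2) / 8) * ?e"
    by (intro mult_right_mono insert.IH meas' bd') simp
  also have "(\<integral>x. ?V' x \<partial>PiM J M) = (\<integral>x. V x \<partial>PiM (insert i J) M)"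
    by (intro product_integral_insert[symmetric] insert.hyps integrable_bounded_differences[OF fin _ bd]) simp
  finally show ?case
    using insert.hyps by (simp add: mult_exp_exp algebra_simps add_divide_distrib)
qed

text \<open>
  Chernoff's method: Markov's inequality for \<open>exp (l * V)\<close> with the \<open>l\<close> that minimizes the exponent
  \<open>l\<^sup>2 * C / 8 - l * t\<close>, where \<open>C\<close> is the sum of the squared differences.
\<close>
theorem McDiarmid:
  assumes J: "finite J" and [measurable]: "V \<in> borel_measurable (PiM J M)"
    and bd: "bounded_differences J M c V" and t: "t > 0" and c: "(\<Sum>i\<in>J. (c i)\<^sup>2) > 0"
  shows "\<P>(x in PiM J M. V x \<ge> (\<integral>x. V x \<partial>PiM J M) + t) \<le> exp (- 2 * t\<^sup>2 / (\<Sum>i\<in>J. (c i)\<^sup>2))"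
proof -
  define C where "C = (\<Sum>i\<in>J. (c i)\<^sup>2)"
  define \<mu> where "\<mu> = (\<integral>x. V x \<partial>PiM J M)"
  define l where "l = 4 * t / C"
  have "C > 0" "l > 0" using t c by (auto simp: l_def C_def)
  have "\<P>(x in PiM J M. V x \<ge> \<mu> + t) = \<P>(x in PiM J M. exp (l * V x) \<ge> exp (l * (\<mu> + t)))"
    using \<open>l > 0\<close> by simp
  also have "\<dots> \<le> (\<integral>x. exp (l * V x) \<partial>PiM J M) / exp (l * (\<mu> + t))"
    by (intro integral_Markov_inequality_measure[where A = "{}"]
        integrable_exp_bounded_differences[OF J _ bd \<open>l > 0\<close>]) auto
  also have "\<dots> \<le> exp (l * \<mu> + l\<^sup>2 * C / 8) / exp (l * (\<mu> + t))"
    unfolding \<mu>_def C_def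
    by (intro divide_right_mono mgf_bounded_differences J bd \<open>l > 0\<close>) auto
  also have "\<dots> = exp (l\<^sup>2 * C / 8 - l * t)"
    by (simp add: exp_diff[symmetric] algebra_simps)
  also have "l\<^sup>2 * C / 8 - l * t = - 2 * t\<^sup>2 / C"
    using \<open>C > 0\<close> by (simp add: l_def field_simps power2_eq_square)
  finally show ?thesis by (simp add: C_def \<mu>_def)
qed

end

section \<open>Interleaving independent samples\<close>

definition interleave :: "'i set \<Rightarrow> ('i \<Rightarrow> bool) \<Rightarrow> ('i \<Rightarrow> 'a) \<Rightarrow> ('i \<Rightarrow> 'a) \<Rightarrow> 'i \<Rightarrow> 'a" where
  "interleave J b x y = (\<lambda>i\<in>J. if b i then y i else x i)"

lemma measurable_interleave [measurable]:
  "(\<lambda>(x, y). interleave J b x y) \<in> PiM J M \<Otimes>\<^sub>M PiM J M \<rightarrow>\<^sub>M PiM J M"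
  unfolding interleave_def case_prod_beta by measurable

text \<open>
  Choosing, coordinate by coordinate, from one of two independent samples gives a sample with the same
  law. On boxes this is seen directly: the preimage of a box is the product of two boxes, one for each
  of the two samples, and each factor of the original box occurs in exactly one of them, the other
  one being unconstrained in that coordinate.
\<close>
lemma (in product_prob_space) distr_interleave:
  assumes J: "finite J"
  shows "distr (PiM J M \<Otimes>\<^sub>M PiM J M) (PiM J M) (\<lambda>(x, y). interleave J b x y) = PiM J M"
proof (rule PiM_eqI[OF J])
  interpret J: prob_space "PiM J M" by (intro prob_space_PiM prob_space)
  fix A assume A: "\<And>i. i \<in> J \<Longrightarrow> A i \<in> sets (M i)"
  define B where "B c i = (if b i = c then A i else space (M i))" for c i
  have B: "B c i \<in> sets (M i)" if "i \<in> J" for c i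
    using A[OF that] by (simp add: B_def)
  have sub: "A i \<subseteq> space (M i)" if "i \<in> J" for i
    using A[OF that] sets.sets_into_space by blast
  have "(\<lambda>(x, y). interleave J b x y) -` PiE J A \<inter> space (PiM J M \<Otimes>\<^sub>M PiM J M)
      = PiE J (B False) \<times> PiE J (B True)"
    using sub by (auto simp: interleave_def B_def space_pair_measure space_PiM PiE_iff split: if_splits)
       (metis subsetD)+
  then have "emeasure (distr (PiM J M \<Otimes>\<^sub>M PiM J M) (PiM J M) (\<lambda>(x, y). interleave J b x y)) (PiE J A)
      = emeasure (PiM J M \<Otimes>\<^sub>M PiM J M) (PiE J (B False) \<times> PiE J (B True))"
    using A J by (subst emeasure_distr) (auto intro!: sets_PiM_I_finite)
  also have "\<dots> = (\<Prod>i\<in>J. emeasure (M i) (B False i)) * (\<Prod>i\<in>J. emeasure (M i) (B True i))"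
    using B J by (subst J.emeasure_pair_measure_Times) (auto intro!: sets_PiM_I_finite simp: emeasure_PiM)
  also have "\<dots> = (\<Prod>i\<in>J. emeasure (M i) (A i))"
    unfolding prod.distrib[symmetric]
    by (intro prod.cong refl) (auto simp: B_def M.emeasure_space_1)
  finally show "emeasure (distr (PiM J M \<Otimes>\<^sub>M PiM J M) (PiM J M) (\<lambda>(x, y). interleave J b x y)) (PiE J A)
      = (\<Prod>i\<in>J. emeasure (M i) (A i))" .
qed simp

section \<open>Symmetrization and uniform deviation\<close>

lemma set_rademacher_signs: "set_pmf (rademacher_signs n) = PiE_dflt {..<n} 0 (\<lambda>_. {-1, 1})"
  by (simp add: rademacher_signs_def set_Pi_pmf comp_def)

lemma finite_rademacher_signs [simp]: "finite (set_pmf (rademacher_signs n))"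
  by (simp add: set_rademacher_signs finite_PiE_dflt)

lemma rademacher_sign: "\<sigma> \<in> set_pmf (rademacher_signs n) \<Longrightarrow> i < n \<Longrightarrow> \<sigma> i = -1 \<or> \<sigma> i = 1"
  by (auto simp: set_rademacher_signs PiE_dflt_def)

definition signed_sup :: "nat \<Rightarrow> ('z \<Rightarrow> real) set \<Rightarrow> (nat \<Rightarrow> real) \<Rightarrow> (nat \<Rightarrow> 'z) \<Rightarrow> real" where
  "signed_sup n G \<sigma> z = (SUP g\<in>G. \<bar>\<Sum>i<n. \<sigma> i * g (z i)\<bar>)"

text \<open>
  For a sign vector \<open>\<sigma>\<close>, swap the two samples \<open>S\<close> and \<open>T\<close> in the coordinates where \<open>\<sigma> i = -1\<close>. The first
  interleaving below is what then stands in the place of \<open>T\<close>, the second what stands in the place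
  of \<open>S\<close>. The average is built from suprema over samples of size \<open>n\<close> only, so that it is measurable
  as soon as these are; a supremum over the differences of the two samples need not be.
\<close>
definition ghost_sup :: "nat \<Rightarrow> ('z \<Rightarrow> real) set \<Rightarrow> (nat \<Rightarrow> 'z) \<Rightarrow> (nat \<Rightarrow> 'z) \<Rightarrow> real" where
  "ghost_sup n G S T = measure_pmf.expectation (rademacher_signs n) (\<lambda>\<sigma>. 1 / real n *
     (signed_sup n G \<sigma> (interleave {..<n} (\<lambda>i. \<sigma> i = 1) S T) +
      signed_sup n G \<sigma> (interleave {..<n} (\<lambda>i. \<sigma> i = -1) S T)))"

lemma expectation_rademacher_signs:
  fixes \<phi> :: "(nat \<Rightarrow> real) \<Rightarrow> real"
  shows "measure_pmf.expectation (rademacher_signs n) \<phi> =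
    (\<Sum>\<sigma>\<in>set_pmf (rademacher_signs n). pmf (rademacher_signs n) \<sigma> * \<phi> \<sigma>)"
  by (subst integral_measure_pmf[of "set_pmf (rademacher_signs n)"]) auto

lemma sum_rademacher_signs_const:
  "(\<Sum>\<sigma>\<in>set_pmf (rademacher_signs n). pmf (rademacher_signs n) \<sigma> * c) = c"
  unfolding expectation_rademacher_signs[symmetric] by simp

lemma emp_rademacher_eq:
  "emp_rademacher n G z =
    measure_pmf.expectation (rademacher_signs n) (\<lambda>\<sigma>. 1 / real n * signed_sup n G \<sigma> z)"
  by (simp add: emp_rademacher_def signed_sup_def)

text \<open>
  A class of measurable functions with values in the unit interval. Uncountable suprema of
  measurable functions may fail to be measurable; the only ones required to be measurable are
  those that occur in the definition of the Rademacher average.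
\<close>
locale unit_bounded_class = prob_space P for P :: "'z measure" +
  fixes n :: nat and G :: "('z \<Rightarrow> real) set"
  assumes n: "n \<ge> 1" and G: "G \<noteq> {}"
    and unit: "g \<in> G \<Longrightarrow> g z \<in> {0..1}"
    and meas [measurable]: "g \<in> G \<Longrightarrow> g \<in> borel_measurable P"
    and meas_signed_sup [measurable]:
      "\<sigma> \<in> {..<n} \<rightarrow> {-1, 1} \<Longrightarrow> signed_sup n G \<sigma> \<in> borel_measurable (iid {..<n} P)"
begin

abbreviation "signs \<equiv> set_pmf (rademacher_signs n)"
abbreviation "Sample \<equiv> iid {..<n} P"

sublocale PP: product_prob_space "\<lambda>_::nat. P" "{..<n}"
  by (intro product_prob_spaceI) unfold_locales

sublocale SS: pair_prob_space Sample Sample ..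

lemma integrable_unit: "g \<in> G \<Longrightarrow> integrable P g"
  using unit by (intro integrable_const_bound[of _ 1] AE_I2) auto

lemma abs_signed_sum_le:
  assumes "\<sigma> \<in> signs" "g \<in> G"
  shows "\<bar>\<Sum>i<n. \<sigma> i * g (z i)\<bar> \<le> real n"
proof -
  have "\<bar>\<Sum>i<n. \<sigma> i * g (z i)\<bar> \<le> (\<Sum>i<n. \<bar>\<sigma> i * g (z i)\<bar>)" by (rule sum_abs)
  also have "\<dots> \<le> (\<Sum>i<n. 1)"
  proof (rule sum_mono)
    fix i assume "i \<in> {..<n}"
    then show "\<bar>\<sigma> i * g (z i)\<bar> \<le> 1"
      using unit[OF assms(2), of "z i"] rademacher_sign[OF assms(1), of i] by auto
  qed
  finally show ?thesis by simp
qed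

lemma signed_sup_upper:
  assumes "\<sigma> \<in> signs" "g \<in> G"
  shows "\<bar>\<Sum>i<n. \<sigma> i * g (z i)\<bar> \<le> signed_sup n G \<sigma> z"
  unfolding signed_sup_def
  by (intro cSUP_upper bdd_aboveI2[of _ _ "real n"] abs_signed_sum_le assms)

lemma signed_sup_least:
  "(\<And>g. g \<in> G \<Longrightarrow> \<bar>\<Sum>i<n. \<sigma> i * g (z i)\<bar> \<le> B) \<Longrightarrow> signed_sup n G \<sigma> z \<le> B"
  unfolding signed_sup_def using G by (intro cSUP_least)

lemma abs_signed_sup_le:
  assumes "\<sigma> \<in> signs"
  shows "\<bar>signed_sup n G \<sigma> z\<bar> \<le> real n"
proof -
  obtain g where "g \<in> G" using G by blast
  then have "0 \<le> signed_sup n G \<sigma> z"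
    using signed_sup_upper[OF assms] by (meson abs_ge_zero order_trans)
  moreover have "signed_sup n G \<sigma> z \<le> real n"
    by (intro signed_sup_least abs_signed_sum_le assms)
  ultimately show ?thesis by simp
qed

lemma signed_sup_upd_le:
  assumes \<sigma>: "\<sigma> \<in> signs" and k: "k < n"
  shows "signed_sup n G \<sigma> (z(k := u)) \<le> signed_sup n G \<sigma> z + 1"
proof (rule signed_sup_least)
  fix g assume g: "g \<in> G"
  have "(\<Sum>i<n. \<sigma> i * g ((z(k := u)) i)) - (\<Sum>i<n. \<sigma> i * g (z i))
      = (\<Sum>i<n. if i = k then \<sigma> k * (g u - g (z k)) else 0)"
    unfolding sum_subtractf[symmetric] by (intro sum.cong refl) (auto simp: algebra_simps)
  also have "\<dots> = \<sigma> k * (g u - g (z k))"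
    using k by simp
  also have "\<bar>\<dots>\<bar> \<le> 1"
    using unit[OF g, of u] unit[OF g, of "z k"] rademacher_sign[OF \<sigma> k] by auto
  finally show "\<bar>\<Sum>i<n. \<sigma> i * g ((z(k := u)) i)\<bar> \<le> signed_sup n G \<sigma> z + 1"
    using signed_sup_upper[OF \<sigma> g, of z] by linarith
qed

text \<open>
  Replacing one sample point moves every signed sum by at most 1, since \<open>g\<close> has values in the unit
  interval, and therefore also moves the supremum by at most 1.
\<close>
lemma signed_sup_upd:
  assumes \<sigma>: "\<sigma> \<in> signs" and k: "k < n"
  shows "\<bar>signed_sup n G \<sigma> (z(k := u)) - signed_sup n G \<sigma> z\<bar> \<le> 1"
  using signed_sup_upd_le[OF assms, of z u] signed_sup_upd_le[OF assms, of "z(k := u)" "z k"] by simp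

lemma signed_sup_measurable [measurable]:
  "\<sigma> \<in> signs \<Longrightarrow> signed_sup n G \<sigma> \<in> borel_measurable Sample"
  by (rule meas_signed_sup) (auto dest: rademacher_sign)

lemma integrable_signed_sup: "\<sigma> \<in> signs \<Longrightarrow> integrable Sample (signed_sup n G \<sigma>)"
  by (intro PP.integrable_const_bound[of _ "real n"] AE_I2) (auto simp: abs_signed_sup_le)

lemma rademacher_eq:
  "rademacher P n G = measure_pmf.expectation (rademacher_signs n)
     (\<lambda>\<sigma>. 1 / real n * (\<integral>z. signed_sup n G \<sigma> z \<partial>Sample))"
  unfolding rademacher_def emp_rademacher_eq expectation_rademacher_signs
  by (subst Bochner_Integration.integral_sum) (auto intro!: integrable_signed_sup)

lemma measurable_signed_sup_interleave [measurable]: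
  "\<sigma> \<in> signs \<Longrightarrow>
    (\<lambda>(S, T). signed_sup n G \<sigma> (interleave {..<n} b S T)) \<in> borel_measurable (Sample \<Otimes>\<^sub>M Sample)"
  using measurable_compose[OF measurable_interleave signed_sup_measurable]
  by (simp add: case_prod_beta)

lemma integrable_signed_sup_interleave:
  "\<sigma> \<in> signs \<Longrightarrow>
    integrable (Sample \<Otimes>\<^sub>M Sample) (\<lambda>(S, T). signed_sup n G \<sigma> (interleave {..<n} b S T))"
  by (intro SS.P.integrable_const_bound[of _ "real n"] AE_I2) (auto simp: abs_signed_sup_le)

lemma integral_signed_sup_interleave:
  assumes "\<sigma> \<in> signs"
  shows "(\<integral>(S, T). signed_sup n G \<sigma> (interleave {..<n} b S T) \<partial>(Sample \<Otimes>\<^sub>M Sample))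
    = (\<integral>z. signed_sup n G \<sigma> z \<partial>Sample)"
proof -
  have "(\<integral>z. signed_sup n G \<sigma> z \<partial>Sample) = (\<integral>z. signed_sup n G \<sigma> z
      \<partial>distr (Sample \<Otimes>\<^sub>M Sample) Sample (\<lambda>(S, T). interleave {..<n} b S T))"
    by (simp add: PP.distr_interleave)
  also have "\<dots> = (\<integral>(S, T). signed_sup n G \<sigma> (interleave {..<n} b S T) \<partial>(Sample \<Otimes>\<^sub>M Sample))"
    using signed_sup_measurable[OF assms]
    by (subst integral_distr[OF measurable_interleave]) (simp_all add: case_prod_beta')
  finally show ?thesis ..
qed

lemma integrable_ghost_sup: "integrable (Sample \<Otimes>\<^sub>M Sample) (\<lambda>(S, T). ghost_sup n G S T)"
  using integrable_signed_sup_interleave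
  unfolding ghost_sup_def expectation_rademacher_signs case_prod_beta
  by (intro Bochner_Integration.integrable_sum integrable_mult_right Bochner_Integration.integrable_add) auto

lemma measurable_ghost_sup [measurable]:
  "(\<lambda>(S, T). ghost_sup n G S T) \<in> borel_measurable (Sample \<Otimes>\<^sub>M Sample)"
  using integrable_ghost_sup by blast

text \<open>
  Both interleavings of two independent samples are again samples, so for each fixed \<open>\<sigma>\<close> the two summands
  have the same mean as the supremum for a single sample.
\<close>
lemma integral_ghost_sup:
  "(\<integral>(S, T). ghost_sup n G S T \<partial>(Sample \<Otimes>\<^sub>M Sample)) = 2 * rademacher P n G"
proof -
  note int = integrable_signed_sup_interleave[unfolded case_prod_beta]
  note eq = integral_signed_sup_interleave[unfolded case_prod_beta]
  show ?thesis
    unfolding ghost_sup_def rademacher_eq expectation_rademacher_signs case_prod_beta sum_distrib_left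
    by (subst Bochner_Integration.integral_sum)
      (auto simp: int eq intro!: sum.cong)
qed

lemma abs_ghost_sup_le: "\<bar>ghost_sup n G S T\<bar> \<le> 2"
proof -
  have *: "\<bar>1 / real n * (signed_sup n G \<sigma> z + signed_sup n G \<sigma> z')\<bar> \<le> 2" if "\<sigma> \<in> signs" for \<sigma> z z'
    using abs_signed_sup_le[OF that, of z] abs_signed_sup_le[OF that, of z'] n
    by (simp add: abs_mult divide_simps)
  have "\<bar>ghost_sup n G S T\<bar> \<le> (\<Sum>\<sigma>\<in>signs. pmf (rademacher_signs n) \<sigma> * 2)"
    unfolding ghost_sup_def expectation_rademacher_signs
    by (intro order.trans[OF sum_abs] sum_mono, subst abs_mult) (simp add: * mult_left_mono del: times_divide_eq_left)
  also have "\<dots> = 2"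
    by (rule sum_rademacher_signs_const)
  finally show ?thesis .
qed

text \<open>
  The point \<open>S k\<close> appears in exactly one of the two interleavings, whatever the sign \<open>\<sigma> k\<close> is. This is why
  the sum of the two suprema moves by at most 1 rather than by 2, and it gives McDiarmid's
  inequality with the same constant as for the uniform deviation itself.
\<close>
lemma ghost_sup_upd:
  assumes k: "k < n"
  shows "\<bar>ghost_sup n G (S(k := u)) T - ghost_sup n G S T\<bar> \<le> 1 / real n"
proof -
  let ?A = "\<lambda>\<sigma> S. signed_sup n G \<sigma> (interleave {..<n} (\<lambda>i. \<sigma> i = 1) S T)"
  let ?B = "\<lambda>\<sigma> S. signed_sup n G \<sigma> (interleave {..<n} (\<lambda>i. \<sigma> i = -1) S T)"
  have upd: "interleave {..<n} b (S(k := u)) T =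
      (if b k then interleave {..<n} b S T else (interleave {..<n} b S T)(k := u))" for b
    using k by (auto simp: interleave_def)
  have one: "\<bar>(?A \<sigma> (S(k := u)) + ?B \<sigma> (S(k := u))) - (?A \<sigma> S + ?B \<sigma> S)\<bar> \<le> 1" if \<sigma>: "\<sigma> \<in> signs" for \<sigma>
    using signed_sup_upd[OF \<sigma> k] rademacher_sign[OF \<sigma> k] unfolding upd by auto
  have "\<bar>ghost_sup n G (S(k := u)) T - ghost_sup n G S T\<bar> \<le>
      (\<Sum>\<sigma>\<in>signs. \<bar>pmf (rademacher_signs n) \<sigma> *
        (1 / real n * ((?A \<sigma> (S(k := u)) + ?B \<sigma> (S(k := u))) - (?A \<sigma> S + ?B \<sigma> S)))\<bar>)"
    unfolding ghost_sup_def expectation_rademacher_signs sum_subtractf[symmetric] right_diff_distrib[symmetric]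
    by (rule sum_abs)
  also have "\<dots> \<le> (\<Sum>\<sigma>\<in>signs. pmf (rademacher_signs n) \<sigma> * (1 / real n * 1))"
    unfolding abs_mult
    by (intro sum_mono mult_mono one) auto
  also have "\<dots> = 1 / real n * 1"
    by (rule sum_rademacher_signs_const)
  finally show ?thesis by simp
qed

text \<open>
  Symmetrization as a pointwise statement: for every \<open>\<sigma>\<close>, the difference of the two sample sums is the
  difference of the \<open>\<sigma>\<close>-signed sums over the two interleavings, because the swap of the two points at
  \<open>i\<close> and the sign \<open>\<sigma> i\<close> cancel. As the bound holds for each \<open>\<sigma>\<close>, it holds for the average over \<open>\<sigma>\<close>.
\<close>
lemma mean_difference_le_ghost_sup:
  assumes g: "g \<in> G"
  shows "1 / real n * (\<Sum>i<n. g (T i)) - 1 / real n * (\<Sum>i<n. g (S i)) \<le> ghost_sup n G S T"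
proof -
  let ?A = "\<lambda>\<sigma>. interleave {..<n} (\<lambda>i. \<sigma> i = 1) S T"
  let ?B = "\<lambda>\<sigma>. interleave {..<n} (\<lambda>i. \<sigma> i = -1) S T"
  let ?d = "1 / real n * ((\<Sum>i<n. g (T i)) - (\<Sum>i<n. g (S i)))"
  have le: "?d \<le> 1 / real n * (signed_sup n G \<sigma> (?A \<sigma>) + signed_sup n G \<sigma> (?B \<sigma>))"
    if \<sigma>: "\<sigma> \<in> signs" for \<sigma>
  proof -
    have "(\<Sum>i<n. g (T i)) - (\<Sum>i<n. g (S i)) = (\<Sum>i<n. \<sigma> i * g (?A \<sigma> i)) - (\<Sum>i<n. \<sigma> i * g (?B \<sigma> i))"
      unfolding sum_subtractf[symmetric]
      by (intro sum.cong refl) (use rademacher_sign[OF \<sigma>] in \<open>auto simp: interleave_def\<close>)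
    also have "\<dots> \<le> signed_sup n G \<sigma> (?A \<sigma>) + signed_sup n G \<sigma> (?B \<sigma>)"
      using signed_sup_upper[OF \<sigma> g, of "?A \<sigma>"] signed_sup_upper[OF \<sigma> g, of "?B \<sigma>"] by linarith
    finally show ?thesis by (intro mult_left_mono) auto
  qed
  have "?d = (\<Sum>\<sigma>\<in>signs. pmf (rademacher_signs n) \<sigma> * ?d)"
    by (rule sum_rademacher_signs_const[symmetric])
  also have "\<dots> \<le> ghost_sup n G S T"
    unfolding ghost_sup_def expectation_rademacher_signs
    by (intro sum_mono mult_left_mono le) auto
  finally show ?thesis by (simp add: right_diff_distrib)
qed

text \<open>
  A measurable substitute for the supremum over the class of the true mean minus the empirical mean
  on \<open>S\<close>: it dominates this supremum, its mean is twice the Rademacher average, and its differences are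
  bounded by \<open>1 / n\<close>.
\<close>
definition deviation_majorant :: "(nat \<Rightarrow> 'z) \<Rightarrow> real" where
  "deviation_majorant S = (\<integral>T. ghost_sup n G S T \<partial>Sample)"

lemma measurable_deviation_majorant [measurable]:
  "deviation_majorant \<in> borel_measurable Sample"
  unfolding deviation_majorant_def by measurable

lemma integrable_ghost_section: "S \<in> space Sample \<Longrightarrow> integrable Sample (ghost_sup n G S)"
  using measurable_Pair2[OF measurable_ghost_sup, of S]
  by (intro PP.integrable_const_bound[of _ 2] AE_I2) (auto simp: abs_ghost_sup_le)

lemma integral_deviation_majorant:
  "(\<integral>S. deviation_majorant S \<partial>Sample) = 2 * rademacher P n G"
  unfolding deviation_majorant_def integral_ghost_sup[symmetric]
  using SS.integral_fst'[OF integrable_ghost_sup] by (simp add: case_prod_beta)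

lemma bounded_differences_deviation_majorant:
  "bounded_differences {..<n} (\<lambda>_. P) (\<lambda>_. 1 / real n) deviation_majorant"
  unfolding bounded_differences_def
proof safe
  fix S k u assume S: "S \<in> space Sample" and k: "k < n" and u: "u \<in> space P"
  have Su: "S(k := u) \<in> space Sample"
    using S k u by (auto simp: space_PiM PiE_iff extensional_def)
  let ?h = "\<lambda>T. ghost_sup n G (S(k := u)) T - ghost_sup n G S T"
  have "deviation_majorant (S(k := u)) - deviation_majorant S = (\<integral>T. ?h T \<partial>Sample)"
    unfolding deviation_majorant_def
    by (intro Bochner_Integration.integral_diff[symmetric] integrable_ghost_section S Su)
  also have "\<bar>\<dots>\<bar> \<le> (\<integral>T. \<bar>?h T\<bar> \<partial>Sample)" by (rule integral_abs_bound)
  also have "\<dots> \<le> (\<integral>T. 1 / real n \<partial>Sample)"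
    by (intro integral_mono Bochner_Integration.integrable_abs Bochner_Integration.integrable_diff
        integrable_ghost_section S Su ghost_sup_upd k) auto
  finally show "\<bar>deviation_majorant (S(k := u)) - deviation_majorant S\<bar> \<le> 1 / real n"
    by (simp add: PP.P.prob_space)
qed

text \<open>
  The true mean is the expectation of the empirical mean on an independent ghost sample \<open>T\<close>.
\<close>
lemma deviation_le_majorant:
  assumes g: "g \<in> G" and S: "S \<in> space Sample"
  shows "expectation g - 1 / real n * (\<Sum>i<n. g (S i)) \<le> deviation_majorant S"
proof -
  note [measurable] = meas[OF g]
  have int: "integrable Sample (\<lambda>T. g (T i))" if "i < n" for i
    using that unit[OF g] by (intro PP.integrable_const_bound[of _ 1] AE_I2) auto
  have comp: "(\<integral>T. g (T i) \<partial>Sample) = expectation g" if i: "i < n" for i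
  proof -
    have "expectation g = (\<integral>x. g x \<partial>distr Sample P (\<lambda>T. T i))"
      using PP.PiM_component[of i] i by simp
    also have "\<dots> = (\<integral>T. g (T i) \<partial>Sample)" using i by (intro integral_distr) auto
    finally show ?thesis ..
  qed
  let ?m = "\<lambda>T. 1 / real n * (\<Sum>i<n. g (T i))"
  have int': "integrable Sample ?m"
    using int by (intro integrable_mult_right Bochner_Integration.integrable_sum) auto
  have "(\<integral>T. ?m T \<partial>Sample) = 1 / real n * (\<Sum>i<n. expectation g)"
    using int comp by (simp add: Bochner_Integration.integral_sum)
  then have "expectation g - ?m S = (\<integral>T. ?m T - ?m S \<partial>Sample)"
    using n int' by (simp add: PP.P.prob_space)
  also have "\<dots> \<le> deviation_majorant S"
    unfolding deviation_majorant_def using int'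
    by (intro integral_mono integrable_ghost_section S mean_difference_le_ghost_sup g
        Bochner_Integration.integrable_diff) auto
  finally show ?thesis .
qed

text \<open>
  McDiarmid's inequality for the majorant; \<open>\<delta>\<close> is the value of \<open>exp (- 2 * n * t\<^sup>2)\<close> at the square root that
  appears in the bound. The conclusion asserts a measurable event of large probability, as the set of
  samples for which the deviation bound holds need not be measurable.
\<close>
theorem uniform_deviation:
  assumes \<delta>: "0 < \<delta>" "\<delta> < 1"
  obtains E where "E \<in> sets Sample" "measure Sample E \<ge> 1 - \<delta>"
    "\<And>S g. S \<in> E \<Longrightarrow> g \<in> G \<Longrightarrow>
      expectation g \<le> 1 / real n * (\<Sum>i<n. g (S i)) + 2 * rademacher P n G + sqrt (ln (1 / \<delta>) / (2 * real n))"
proof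
  define t where "t = sqrt (ln (1 / \<delta>) / (2 * real n))"
  define E where "E = {S \<in> space Sample. \<not> 2 * rademacher P n G + t \<le> deviation_majorant S}"
  have ln: "ln (1 / \<delta>) > 0" using \<delta> by (intro ln_gt_zero) simp
  then have "t > 0" using n by (simp add: t_def)
  have t2: "t\<^sup>2 = ln (1 / \<delta>) / (2 * real n)" using ln n by (simp add: t_def)
  have sum: "(\<Sum>i<n. (1 / real n)\<^sup>2) = 1 / real n"
    using n by (simp add: power2_eq_square)
  have "measure Sample {S \<in> space Sample. 2 * rademacher P n G + t \<le> deviation_majorant S}
      \<le> exp (- 2 * t\<^sup>2 / (1 / real n))"
    using PP.McDiarmid[OF _ _ bounded_differences_deviation_majorant \<open>t > 0\<close>] n
    by (simp only: integral_deviation_majorant sum) simp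
  also have "- 2 * t\<^sup>2 / (1 / real n) = ln \<delta>"
    using n \<delta> by (simp add: t2 ln_div)
  finally have "measure Sample {S \<in> space Sample. 2 * rademacher P n G + t \<le> deviation_majorant S} \<le> \<delta>"
    using \<delta> by simp
  moreover show "E \<in> sets Sample" unfolding E_def by measurable
  ultimately show "measure Sample E \<ge> 1 - \<delta>"
    unfolding E_def by (subst PP.prob_neg) auto
  fix S g assume "S \<in> E" "g \<in> G"
  then show "expectation g \<le> 1 / real n * (\<Sum>i<n. g (S i)) + 2 * rademacher P n G
      + sqrt (ln (1 / \<delta>) / (2 * real n))"
    using deviation_le_majorant[of g S] unfolding E_def t_def by simp
qed

end

section \<open>Coverage and feasibility of robust solutions\<close>

text \<open>
  The test points are independent, so the probabilities of coverage multiply.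
\<close>
lemma prob_joint_coverage:
  fixes M :: "('x \<times> real) measure"
  assumes "prob_space M" and [measurable]: "miscoverage I \<in> borel_measurable M"
  shows "\<P>(T in iid (UNIV :: 'm::finite set) M. \<forall>j. snd (T j) \<in> I (fst (T j)))
    = (1 - (\<integral>z. miscoverage I z \<partial>M)) ^ CARD('m)"
proof -
  interpret M: prob_space M by fact
  interpret J: finite_product_prob_space "\<lambda>_::'m. M" UNIV
    by unfold_locales auto
  define A where "A = {z \<in> space M. miscoverage I z = 0}"
  have A [measurable]: "A \<in> sets M" unfolding A_def by measurable
  have int: "integrable M (miscoverage I)"
    by (intro M.integrable_const_bound[of _ 1] AE_I2 assms(2)) (auto simp: miscoverage_def)
  have "measure M A = (\<integral>z. indicator A z \<partial>M)" by simp
  also have "\<dots> = (\<integral>z. 1 - miscoverage I z \<partial>M)"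
    by (intro Bochner_Integration.integral_cong) (auto simp: A_def miscoverage_def indicator_def)
  also have "\<dots> = 1 - (\<integral>z. miscoverage I z \<partial>M)"
    using int by (simp add: M.prob_space)
  finally have mA: "measure M A = 1 - (\<integral>z. miscoverage I z \<partial>M)" .
  have eq: "{T \<in> space (iid (UNIV :: 'm set) M). \<forall>j. snd (T j) \<in> I (fst (T j))} = PiE UNIV (\<lambda>_. A)"
    by (auto simp: space_PiM A_def miscoverage_def case_prod_beta PiE_iff)
  show ?thesis
    unfolding eq using J.prob_times[of "\<lambda>_. A"] A mA by simp
qed

lemma robust_optimal_feasible:
  "robust_optimal D f F K U \<pi> \<Longrightarrow> u \<in> U \<Longrightarrow> F \<pi> u \<in> K"
  by (simp add: robust_optimal_def is_arg_min_def)

theorem theorem4p1: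
  fixes X :: "(real ^ 'd) set" and Y :: "real set"
    and P :: "((real ^ 'd) \<times> real) measure"
    and n :: nat
    and \<I> :: "(real ^ 'd \<Rightarrow> real set) set"
    and Alg :: "(nat \<Rightarrow> (real ^ 'd) \<times> real) \<Rightarrow> real ^ 'd \<Rightarrow> real set"
    and D :: "(real ^ 'p) set"
    and f :: "real ^ 'p \<Rightarrow> real ^ 'm \<Rightarrow> real"
    and F :: "real ^ 'p \<Rightarrow> real ^ 'm \<Rightarrow> real ^ 'c"
    and K :: "(real ^ 'c) set"
    and pistar :: "(nat \<Rightarrow> (real ^ 'd) \<times> real) \<Rightarrow> ('m \<Rightarrow> real ^ 'd) \<Rightarrow> real ^ 'p"
    and \<delta> :: real
  assumes P: "prob_space P" "sets P = sets (restrict_space borel (X \<times> Y))"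
    and n: "n \<ge> 1"
    and borel_I: "\<And>I x. I \<in> \<I> \<Longrightarrow> x \<in> X \<Longrightarrow> I x \<in> sets borel"
    and Alg: "\<And>S. S \<in> space (iid {..<n} P) \<Longrightarrow> Alg S \<in> \<I>"
    and K: "convex_cone K"
    and pistar: "\<And>S x. S \<in> space (iid {..<n} P) \<Longrightarrow> (\<And>j. x j \<in> X) \<Longrightarrow>
        robust_optimal D f F K (uncertainty_set (Alg S) x) (pistar S x)"
    and meas_loss: "\<And>I. I \<in> \<I> \<Longrightarrow> miscoverage I \<in> borel_measurable P"
    and meas_sup: "\<And>\<sigma>. \<sigma> \<in> {..<n} \<rightarrow> {-1, 1} \<Longrightarrow>
        (\<lambda>z. SUP g\<in>miscoverage ` \<I>. \<bar>\<Sum>i<n. \<sigma> i * g (z i)\<bar>) \<in> borel_measurable (iid {..<n} P)"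
    and meas_Alg: "(\<lambda>S. emp_miscoverage n (Alg S) S) \<in> borel_measurable (iid {..<n} P)"
    and meas_success: "Measurable.pred (iid {..<n} P \<Otimes>\<^sub>M iid UNIV P)
        (\<lambda>(S, T). F (pistar S (\<lambda>j. fst (T j))) (\<chi> j. snd (T j)) \<in> K)"
    and \<delta>: "0 < \<delta>" "\<delta> < 1"
  shows "\<P>(S in iid {..<n} P.
      \<P>(T in iid UNIV P. F (pistar S (\<lambda>j. fst (T j))) (\<chi> j. snd (T j)) \<in> K)
        \<ge> (max 0 (1 - emp_miscoverage n (Alg S) S
                     - 2 * rademacher P n (miscoverage ` \<I>)
                     - sqrt (ln (1 / \<delta>) / (2 * real n)))) ^ CARD('m))
    \<ge> 1 - \<delta>"
proof -
  interpret prob_space P by (rule P)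
  interpret S: prob_space "iid {..<n} P" by (intro prob_space_PiM P)
  interpret T: prob_space "iid (UNIV :: 'm set) P" by (intro prob_space_PiM P)
  obtain S0 where "S0 \<in> space (iid {..<n} P)" using S.not_empty by blast
  then have "\<I> \<noteq> {}" using Alg by blast
  interpret L: unit_bounded_class P n "miscoverage ` \<I>"
  proof unfold_locales
    show "n \<ge> 1" by (rule n)
    show "miscoverage ` \<I> \<noteq> {}" using \<open>\<I> \<noteq> {}\<close> by simp
    show "g z \<in> {0..1}" if "g \<in> miscoverage ` \<I>" for g z
      using that by (auto simp: miscoverage_def case_prod_beta)
    show "g \<in> borel_measurable P" if "g \<in> miscoverage ` \<I>" for g
      using that meas_loss by blast
    show "signed_sup n (miscoverage ` \<I>) \<sigma> \<in> borel_measurable (iid {..<n} P)"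
      if "\<sigma> \<in> {..<n} \<rightarrow> {-1, 1}" for \<sigma>
      unfolding signed_sup_def by (rule meas_sup[OF that])
  qed
  define success where
    "success S T \<longleftrightarrow> F (pistar S (\<lambda>j. fst (T j))) (\<chi> j. snd (T j)) \<in> K"
    for S and T :: "'m \<Rightarrow> (real ^ 'd) \<times> real"
  define bound where
    "bound S = 1 - emp_miscoverage n (Alg S) S - 2 * rademacher P n (miscoverage ` \<I>)
       - sqrt (ln (1 / \<delta>) / (2 * real n))" for S
  have success_meas [measurable]: "Measurable.pred (iid {..<n} P \<Otimes>\<^sub>M iid UNIV P) (\<lambda>(S, T). success S T)"
    using meas_success by (simp add: success_def)
  have "X \<times> Y = space P"
    using sets_eq_imp_space_eq[OF P(2)] by (simp add: space_restrict_space)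
  then have in_X: "fst z \<in> X" if "z \<in> space P" for z
    using that \<open>X \<times> Y = space P\<close> by (metis mem_Times_iff)
  \<comment> \<open>Coverage of every test label puts the label vector into the uncertainty set, where \<open>pistar\<close> is feasible.\<close>
  have success_ge: "(max 0 (bound S)) ^ CARD('m) \<le> \<P>(T in iid UNIV P. success S T)"
    if S: "S \<in> space (iid {..<n} P)"
      and dev: "expectation (miscoverage (Alg S)) \<le> 1 - bound S" for S
  proof -
    \<comment> \<open>The truncation at 0 is harmless because a probability of coverage is nonnegative.\<close>
    have "expectation (miscoverage (Alg S)) \<le> 1"
      using L.unit Alg[OF S] by (intro integral_le_const L.integrable_unit AE_I2) auto
    then have "(max 0 (bound S)) ^ CARD('m) \<le> (1 - expectation (miscoverage (Alg S))) ^ CARD('m)"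
      using dev by (intro power_mono) auto
    also have "\<dots> = \<P>(T in iid (UNIV :: 'm set) P. \<forall>j. snd (T j) \<in> Alg S (fst (T j)))"
      by (rule prob_joint_coverage[symmetric]) (use P meas_loss Alg[OF S] in auto)
    also have "\<dots> \<le> \<P>(T in iid UNIV P. success S T)"
    proof (rule T.finite_measure_mono)
      show "{T \<in> space (iid UNIV P). success S T} \<in> sets (iid UNIV P)"
        using measurable_Pair2[OF success_meas S] by (simp add: pred_def)
      show "{T \<in> space (iid UNIV P). \<forall>j. snd (T j) \<in> Alg S (fst (T j))}
          \<subseteq> {T \<in> space (iid UNIV P). success S T}"
      proof safe
        fix T :: "'m \<Rightarrow> (real ^ 'd) \<times> real"
        assume T: "T \<in> space (iid UNIV P)" and cov: "\<forall>j. snd (T j) \<in> Alg S (fst (T j))"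
        have "fst (T j) \<in> X" for j using T by (intro in_X) (auto simp: space_PiM)
        from pistar[OF S this]
        have "robust_optimal D f F K (uncertainty_set (Alg S) (\<lambda>j. fst (T j))) (pistar S (\<lambda>j. fst (T j)))" .
        then show "success S T"
          unfolding success_def
          by (rule robust_optimal_feasible) (simp add: uncertainty_set_def cov)
      qed
    qed
    finally show ?thesis .
  qed
  obtain E where E: "E \<in> sets (iid {..<n} P)" "S.prob E \<ge> 1 - \<delta>"
    and dev: "\<And>S g. S \<in> E \<Longrightarrow> g \<in> miscoverage ` \<I> \<Longrightarrow> expectation g \<le>
      1 / real n * (\<Sum>i<n. g (S i)) + 2 * rademacher P n (miscoverage ` \<I>) + sqrt (ln (1 / \<delta>) / (2 * real n))"
    using L.uniform_deviation[OF \<delta>] by blast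
  have "S.prob E \<le> \<P>(S in iid {..<n} P. (max 0 (bound S)) ^ CARD('m) \<le> \<P>(T in iid UNIV P. success S T))"
  proof (rule S.finite_measure_mono)
    \<comment> \<open>Measurability keeps the probability in the goal from being that of a non-measurable set, which is 0 by convention.\<close>
    have [measurable]: "bound \<in> borel_measurable (iid {..<n} P)"
      unfolding bound_def using meas_Alg by measurable
    have [measurable]: "(\<lambda>S. \<P>(T in iid UNIV P. success S T)) \<in> borel_measurable (iid {..<n} P)"
      by (rule T.measurable_measure) measurable
    show "{S \<in> space (iid {..<n} P). (max 0 (bound S)) ^ CARD('m) \<le> \<P>(T in iid UNIV P. success S T)}
        \<in> sets (iid {..<n} P)"
      by measurable
    show "E \<subseteq> {S \<in> space (iid {..<n} P). (max 0 (bound S)) ^ CARD('m) \<le> \<P>(T in iid UNIV P. success S T)}"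
    proof safe
      fix S assume "S \<in> E"
      then show S: "S \<in> space (iid {..<n} P)" using sets.sets_into_space[OF E(1)] by blast
      have "miscoverage (Alg S) \<in> miscoverage ` \<I>" using Alg[OF S] by simp
      from dev[OF \<open>S \<in> E\<close> this]
      show "(max 0 (bound S)) ^ CARD('m) \<le> \<P>(T in iid UNIV P. success S T)"
        by (intro success_ge S) (simp add: bound_def emp_miscoverage_def)
    qed
  qed
  with E(2) show ?thesis
    unfolding success_def bound_def by linarith
qed

end
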